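(* Let $S$ be a nonempty finite set of integers with $\max S = m$. Then $S$ is an admissible pinnacle set if and only if both of the following hold: (1) $S\setminus\{m\}$ is an admissible pinnacle set, and (2) $m > 2|S|$. Moreover, for every integer $m\ge 2$ there are exactly $\binom{m-2}{\lfloor m/2\rfloor}$ admissible pinnacle sets with maximum $m$, and for every integer $n\ge 1$ the number of admissible pinnacle sets $S\subseteq [n]$ (including $S=\emptyset$) is $$1+\sum_{m=3}^{n}\binom{m-2}{\lfloor m/2\rfloor}=\binom{n-1}{\lfloor (n-1)/2\rfloor}.$$
   Context: Let $[n]=\{1,2,\ldots,n\}$ and let $S_n$ be the set of permutations of $[n]$, written as words $w=w(1)w(2)\cdots w(n)$. A pinnacle of $w\in S_n$ is a value $w(i)$ with $2\le i\le n-1$ and $w(i-1)<w(i)>w(i+1)$. The pinnacle set $\mathrm{Pin}(w)$ is the set of all pinnacles of $w$. A set $S$ is an $n$-admissible pinnacle set if there is $w\in S_n$ with $\mathrm{Pin}(w)=S$; it is an admissible pinnacle set if it is $n$-admissible for some $n\ge 1$. In particular $\emptyset$ is admissible. Convention: $\binom{a}{b}=0$ if $b>a\ge 0$; an empty sum is $0$. *)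

theory Defs
  imports Complex_Main "HOL-Combinatorics.Permutations"
begin

text \<open>
  Permutations of \<open>[n]\<close> are functions on \<open>int\<close> that permute \<open>{1..int n}\<close> (and hence are the
  identity elsewhere). The bounds on \<open>i\<close> below keep \<open>i - 1\<close> and \<open>i + 1\<close> inside \<open>{1..int n}\<close>,
  so the values outside the word play no role.
\<close>

definition pinnacle_set :: "nat \<Rightarrow> (int \<Rightarrow> int) \<Rightarrow> int set" where
  "pinnacle_set n w =
     {w i | i. 2 \<le> i \<and> i \<le> int n - 1 \<and> w (i - 1) < w i \<and> w i > w (i + 1)}"

definition n_admissible :: "nat \<Rightarrow> int set \<Rightarrow> bool" where
  "n_admissible n S \<longleftrightarrow> (\<exists>w. w permutes {1..int n} \<and> pinnacle_set n w = S)"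

definition admissible :: "int set \<Rightarrow> bool" where
  "admissible S \<longleftrightarrow> (\<exists>n\<ge>1. n_admissible n S)"

text \<open>
  \<open>Max\<close> is unspecified on empty and infinite sets, so both are excluded explicitly.
\<close>

definition admissible_with_max :: "int \<Rightarrow> int set set" where
  "admissible_with_max m = {S. admissible S \<and> finite S \<and> S \<noteq> {} \<and> Max S = m}"

end

theory Submission
  imports Defs
begin

text \<open>
  A finite set \<open>s\<^sub>1 < \<dots> < s\<^sub>k\<close> is an admissible pinnacle set iff \<open>s\<^sub>j > 2 j\<close> for all \<open>j\<close>.
  The condition is necessary because the pinnacles \<open>s\<^sub>1, \<dots>, s\<^sub>j\<close>, the letters following them and
  the letter preceding the leftmost of them are \<open>2 j + 1\<close> distinct letters not exceeding \<open>s\<^sub>j\<close>.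
  It is sufficient because, with the remaining letters \<open>c\<^sub>1 < c\<^sub>2 < \<dots>\<close>, the word
  \<open>c\<^sub>1 s\<^sub>1 c\<^sub>2 s\<^sub>2 \<dots> c\<^sub>k s\<^sub>k c\<^sub>k\<^sub>+\<^sub>1 c\<^sub>k\<^sub>+\<^sub>2 \<dots>\<close> has the required pinnacles.

  Sorting by whether the letter \<open>n\<close> occurs, the sets \<open>S \<subseteq> [n]\<close> of this kind with at most \<open>k\<close>
  elements satisfy Pascal's recurrence, and their number is \<open>n - 1\<close> choose \<open>k\<close> if \<open>2 k \<le> n\<close>.
\<close>

section \<open>Ballot sets and their maxima\<close>

text \<open>The cardinality is the rank \<open>j\<close> of \<open>s\<close> in \<open>S\<close>, so
  the condition reads \<open>s\<^sub>j > 2 j\<close> without listing \<open>S\<close> in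
  order.\<close>

definition ballot :: "int set \<Rightarrow> bool" where
  "ballot S \<longleftrightarrow> finite S \<and> (\<forall>s\<in>S. 2 * int (card {t \<in> S. t \<le> s}) < s)"

lemma ballot_empty: "ballot {}"
  by (simp add: ballot_def)

text \<open>A new largest element has rank \<open>card T + 1\<close> and leaves the other ranks
  unchanged. For infinite \<open>T\<close> both sides are false.\<close>

lemma ballot_insert:
  assumes "\<And>t. t \<in> T \<Longrightarrow> t < m"
  shows "ballot (insert m T) \<longleftrightarrow> ballot T \<and> 2 * (int (card T) + 1) < m"
proof (cases "finite T")
  case True
  have "m \<notin> T"
    using assms by blast
  have top: "{t \<in> insert m T. t \<le> m} = insert m T"
    using assms by force
  have below: "{t \<in> insert m T. t \<le> s} = {t \<in> T. t \<le> s}" if "s \<in> T" for s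
    using assms[OF that] by auto
  have "(\<forall>s\<in>insert m T. 2 * int (card {t \<in> insert m T. t \<le> s}) < s) \<longleftrightarrow>
      2 * int (card (insert m T)) < m \<and> (\<forall>s\<in>T. 2 * int (card {t \<in> T. t \<le> s}) < s)"
    by (simp only: Set.ball_simps top below cong: ball_cong)
  then show ?thesis
    using True \<open>m \<notin> T\<close> unfolding ballot_def by (auto simp: add.commute)
qed (simp add: ballot_def)

lemma ballot_card_less_Max:
  assumes "ballot S" "S \<noteq> {}"
  shows "2 * int (card S) < Max S"
proof -
  have fin: "finite S"
    using assms by (simp add: ballot_def)
  then have "{t \<in> S. t \<le> Max S} = S"
    by auto
  then show ?thesis
    using assms Max_in[OF fin] unfolding ballot_def by metis
qed

text \<open>This becomes the recursive criterion of the theorem once admissibility is identified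
  with \<open>ballot\<close>.\<close>

lemma ballot_remove_Max:
  assumes "finite S" "S \<noteq> {}"
  shows "ballot S \<longleftrightarrow> ballot (S - {Max S}) \<and> 2 * int (card S) < Max S"
proof -
  have S: "insert (Max S) (S - {Max S}) = S" "Max S \<in> S"
    using assms Max_in by auto
  have below: "t < Max S" if "t \<in> S - {Max S}" for t
    using that assms by (simp add: order_less_le)
  have "ballot S \<longleftrightarrow> ballot (S - {Max S}) \<and> 2 * (int (card (S - {Max S})) + 1) < Max S"
    using ballot_insert[of "S - {Max S}" "Max S", OF below] unfolding S(1) .
  moreover have "card S = Suc (card (S - {Max S}))"
    using assms(1) S(2) by (rule card.remove)
  ultimately show ?thesis
    by (simp add: add.commute)
qed

section \<open>Necessity: letters around the pinnacles\<close>

lemma ballot_pinnacle_set: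
  assumes w: "w permutes {1..int n}"
  shows "ballot (pinnacle_set n w)"
proof -
  have range: "w i \<in> {1..int n} \<longleftrightarrow> i \<in> {1..int n}" for i
    using w by (rule permutes_in_image)
  have inj: "inj w"
    using w by (rule permutes_inj)
  have sub: "pinnacle_set n w \<subseteq> {1..int n}"
    using range unfolding pinnacle_set_def by fastforce
  have "2 * int (card {t \<in> pinnacle_set n w. t \<le> s}) < s" if s: "s \<in> pinnacle_set n w" for s
  proof -
    define P where "P = {i. 2 \<le> i \<and> i \<le> int n - 1 \<and> w (i - 1) < w i \<and> w i > w (i + 1) \<and> w i \<le> s}"
    have "P \<subseteq> {2..int n - 1}"
      by (auto simp: P_def)
    then have fin: "finite P"
      using finite_subset by blast
    have "{t \<in> pinnacle_set n w. t \<le> s} = w ` P"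
      by (auto simp: P_def pinnacle_set_def)
    then have card_P: "card {t \<in> pinnacle_set n w. t \<le> s} = card P"
      using inj by (metis card_image inj_on_subset subset_UNIV)
    have "P \<noteq> {}"
      using s by (auto simp: P_def pinnacle_set_def)
    with fin have Min: "Min P \<in> P" "\<And>i. i \<in> P \<Longrightarrow> Min P \<le> i"
      by auto
    define Q where "Q = insert (Min P - 1) (P \<union> (+) 1 ` P)"
    \<comment> \<open>Adjacent positions cannot both carry pinnacles, since each of the two letters
      would exceed the other.\<close>
    have "P \<inter> (+) 1 ` P = {}"
      by (force simp: P_def add.commute)
    then have "card (P \<union> (+) 1 ` P) = 2 * card P"
      using fin by (simp add: card_Un_disjoint card_image)
    moreover have "Min P - 1 \<notin> P \<union> (+) 1 ` P"
      using Min(2) by force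
    ultimately have card_Q: "card Q = 2 * card P + 1"
      using fin by (simp add: Q_def)
    \<comment> \<open>Neighbours of a pinnacle are smaller than it, so the injection
      \<open>w\<close> sends \<open>Q\<close> into \<open>{1..s}\<close>, whence
      \<open>2 * card P + 1 \<le> s\<close>.\<close>
    have "w i \<in> {1..s}" if "i \<in> Q" for i
    proof -
      have "i \<in> {1..int n}" "w i \<le> s"
        using that Min(1) by (auto simp: Q_def P_def add.commute)
      then show ?thesis
        using range[of i] by simp
    qed
    then have "w ` Q \<subseteq> {1..s}"
      by blast
    then have "card Q \<le> card {1..s}"
      using inj by (metis card_image card_mono finite_atLeastAtMost_int inj_on_subset subset_UNIV)
    then show ?thesis
      using card_Q card_P by simp
  qed
  then show ?thesis
    using sub finite_subset unfolding ballot_def by blast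
qed

section \<open>Sufficiency: the alternating word\<close>

lemma ballot_n_admissible:
  assumes S: "ballot S" "S \<subseteq> {1..int n}"
  shows "n_admissible n S"
proof (cases "S = {}")
  case True
  have "pinnacle_set n id = {}"
    by (auto simp: pinnacle_set_def)
  then show ?thesis
    unfolding n_admissible_def True using permutes_id by blast
next
  case False
  define k where "k = card S"
  define xs where "xs = sorted_list_of_set S"
  define ys where "ys = sorted_list_of_set ({1..int n} - S)"
  have fin: "finite S"
    using S by (simp add: ballot_def)
  have len_xs: "length xs = k" and set_xs: "set xs = S"
    using fin by (simp_all add: xs_def k_def)
  have len_ys: "length ys = n - k" and set_ys: "set ys = {1..int n} - S"
    using S fin by (simp_all add: ys_def k_def card_Diff_subset)
  have mono_xs: "xs ! i < xs ! j" if "i < j" "j < k" for i j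
    using that strict_sorted_list_of_set[of S] len_xs
    by (simp add: xs_def sorted_wrt_nth_less)
  have mono_ys: "ys ! i < ys ! j" if "i < j" "j < n - k" for i j
    using that strict_sorted_list_of_set[of "{1..int n} - S"] len_ys
    by (simp add: ys_def sorted_wrt_nth_less)
  have "Max S \<in> S"
    using fin False by simp
  \<comment> \<open>At least \<open>k + 1\<close> letters lie outside \<open>S\<close>, enough to
    surround all \<open>k\<close> pinnacles.\<close>
  then have n: "2 * k < n"
    using ballot_card_less_Max[OF S(1) False] S(2) by (force simp: k_def)
  \<comment> \<open>Otherwise every letter up to \<open>xs ! j\<close> is among the first
    \<open>j + 1\<close> entries of \<open>xs\<close> or of \<open>ys\<close>. Then
    \<open>xs ! j \<le> 2 * (j + 1)\<close>, against the ballot condition for the element of rank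
    \<open>j + 1\<close>.\<close>
  have xs_gt: "ys ! Suc j < xs ! j" if j: "j < k" for j
  proof (rule ccontr)
    assume "\<not> ys ! Suc j < xs ! j"
    then have le: "xs ! j \<le> ys ! Suc j"
      by simp
    have xj: "xs ! j \<in> S"
      using j len_xs set_xs nth_mem by blast
    have card_xs: "card ((!) xs ` {..j}) = Suc j"
      using mono_xs j by (subst card_image) (auto simp: inj_on_def, metis le_less_trans linorder_neq_iff)
    have initial: "(!) xs ` {..j} \<subseteq> {t \<in> S. t \<le> xs ! j}"
      using mono_xs j len_xs set_xs by (force simp: le_less intro: nth_mem)
    then have "Suc j \<le> card {t \<in> S. t \<le> xs ! j}"
      using card_mono[OF _ initial] card_xs fin by simp
    then have lower: "2 * (int j + 1) < xs ! j"
      using S(1) xj unfolding ballot_def by force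
    have "{1..xs ! j} \<subseteq> (!) xs ` {..j} \<union> (!) ys ` {..j}"
    proof
      fix t assume t: "t \<in> {1..xs ! j}"
      show "t \<in> (!) xs ` {..j} \<union> (!) ys ` {..j}"
      proof (cases "t \<in> S")
        case True
        then obtain i where i: "i < k" "t = xs ! i"
          using set_xs len_xs by (metis in_set_conv_nth)
        then have "i \<le> j"
          using mono_xs[of j i] t by force
        then show ?thesis
          using i by blast
      next
        case nS: False
        then have "t \<in> {1..int n} - S"
          using t xj S(2) by force
        then obtain i where i: "i < n - k" "t = ys ! i"
          using set_ys len_ys by (metis in_set_conv_nth)
        have "t \<noteq> xs ! j"
          using nS xj by blast
        then have "i \<le> j"
          using mono_ys[of "Suc j" i] t i le by (cases "i = Suc j") force+
        then show ?thesis
          using i by blast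
      qed
    qed
    then have "card {1..xs ! j} \<le> card ((!) xs ` {..j} \<union> (!) ys ` {..j})"
      by (intro card_mono) auto
    also have "\<dots> \<le> card ((!) xs ` {..j}) + card ((!) ys ` {..j})"
      by (rule card_Un_le)
    also have "\<dots> \<le> Suc j + Suc j"
      using card_image_le[of "{..j}" "(!) xs"] card_image_le[of "{..j}" "(!) ys"] by simp
    finally show False
      using lower by simp
  qed
  \<comment> \<open>The word with positions counted from 0: up to \<open>2 * k\<close>, odd
    positions hold \<open>xs\<close> and even ones \<open>ys\<close>. The tail resumes with
    \<open>ys ! Suc k\<close> at position \<open>2 * k + 1\<close>.\<close>
  define u where "u q = (if 2 * k < q then ys ! (q - k)
                         else if odd q then xs ! (q div 2) else ys ! (q div 2))" for q :: nat
  define w where "w i = (if i \<in> {1..int n} then u (nat (i - 1)) else i)" for i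
  have w_u: "w (int q + 1) = u q" if "q < n" for q
    using that by (simp add: w_def)
  have u_x: "u (2 * j + 1) = xs ! j" if "j < k" for j
    using that by (simp add: u_def)
  have u_y: "u (2 * j) = ys ! j" if "j \<le> k" for j
    using that by (simp add: u_def)
  have u_y': "u q = ys ! (q - k)" if "2 * k < q" for q
    using that by (simp add: u_def)
  have "u ` {..<n} = {1..int n}"
  proof
    show "u ` {..<n} \<subseteq> {1..int n}"
    proof safe
      fix q assume q: "q < n"
      have "q div 2 < k" if "odd q" "q \<le> 2 * k"
        using that by (auto elim!: oddE)
      then have "u q \<in> set xs \<union> set ys"
        using q n len_xs len_ys by (auto simp: u_def intro: nth_mem)
      then show "u q \<in> {1..int n}"
        using set_xs set_ys S by auto
    qed
    show "{1..int n} \<subseteq> u ` {..<n}"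
    proof
      fix t assume "t \<in> {1..int n}"
      then consider "t \<in> set xs" | "t \<in> set ys"
        using set_xs set_ys by blast
      then show "t \<in> u ` {..<n}"
      proof cases
        case 1
        then obtain j where j: "j < k" "t = xs ! j"
          using len_xs by (metis in_set_conv_nth)
        then show ?thesis
          using u_x[of j] n by (intro image_eqI[of _ _ "2 * j + 1"]) auto
      next
        case 2
        then obtain j where j: "j < n - k" "t = ys ! j"
          using len_ys by (metis in_set_conv_nth)
        show ?thesis
        proof (cases "j \<le> k")
          case True
          then show ?thesis
            using u_y[of j] n j by (intro image_eqI[of _ _ "2 * j"]) auto
        next
          case False
          then show ?thesis
            using u_y'[of "j + k"] j by (intro image_eqI[of _ _ "j + k"]) auto
        qed
      qed
    qed
  qed
  moreover have "w ` {1..int n} = u ` {..<n}"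
  proof -
    have "{1..int n} = (\<lambda>q. int q + 1) ` {..<n}"
    proof (intro equalityI subsetI)
      fix i assume "i \<in> {1..int n}"
      then show "i \<in> (\<lambda>q. int q + 1) ` {..<n}"
        by (intro image_eqI[of _ _ "nat (i - 1)"]) auto
    qed auto
    then show ?thesis
      by (simp add: image_image w_u)
  qed
  ultimately have img: "w ` {1..int n} = {1..int n}"
    by simp
  then have "bij_betw w {1..int n} {1..int n}"
    by (simp add: bij_betw_def finite_surj_inj)
  then have perm: "w permutes {1..int n}"
    by (rule bij_imp_permutes) (auto simp: w_def)
  have "pinnacle_set n w = S"
  proof
    show "S \<subseteq> pinnacle_set n w"
    proof
      fix x assume "x \<in> S"
      then obtain j where j: "j < k" "x = xs ! j"
        using len_xs set_xs by (metis in_set_conv_nth)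
      let ?i = "int (2 * j + 1) + 1"
      have "w ?i = x"
        using w_u[of "2 * j + 1"] u_x[of j] j n by simp
      moreover have "w (?i - 1) = ys ! j"
        using w_u[of "2 * j"] u_y[of j] j n by (simp add: add.commute)
      moreover have "w (?i + 1) = ys ! Suc j"
        using w_u[of "2 * Suc j"] u_y[of "Suc j"] j n by (simp add: algebra_simps)
      moreover have "ys ! j < ys ! Suc j"
        using mono_ys j n by simp
      ultimately show "x \<in> pinnacle_set n w"
        using j n xs_gt[of j] unfolding pinnacle_set_def
        by (intro CollectI exI[of _ ?i]) auto
    qed
    show "pinnacle_set n w \<subseteq> S"
    proof
      fix x assume "x \<in> pinnacle_set n w"
      then obtain i where i: "x = w i" "2 \<le> i" "i \<le> int n - 1" "w (i - 1) < w i" "w (i + 1) < w i"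
        unfolding pinnacle_set_def by blast
      \<comment> \<open>The left neighbour, the peak and the right neighbour are \<open>u\<close> at
        \<open>q\<close>, \<open>Suc q\<close> and \<open>Suc (Suc q)\<close>.\<close>
      define q where "q = nat (i - 2)"
      have q: "i = int (Suc q) + 1" "Suc (Suc q) < n"
        using i by (auto simp: q_def)
      have pin: "x = u (Suc q)" "u q < u (Suc q)" "u (Suc (Suc q)) < u (Suc q)"
        using i q w_u[of q] w_u[of "Suc q"] w_u[of "Suc (Suc q)"] by (auto simp: algebra_simps)
      show "x \<in> S"
      \<comment> \<open>A peak cannot lie in the increasing tail, nor at an even position up to
        \<open>2 * k\<close>, where the left neighbour is larger by \<open>xs_gt\<close>. Only the
        positions of \<open>xs\<close> remain.\<close>
      proof (cases "2 * k < Suc q")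
        case True
        then have "u (Suc q) < u (Suc (Suc q))"
          using mono_ys[of "Suc q - k" "Suc (Suc q) - k"] q by (simp add: u_y')
        then show ?thesis
          using pin by simp
      next
        case le: False
        show ?thesis
        proof (cases "odd q")
          case True
          then obtain j where j: "q = 2 * j + 1"
            by (rule oddE)
          then have "u (Suc q) < u q"
            using u_x[of j] u_y[of "Suc j"] xs_gt[of j] le by simp
          then show ?thesis
            using pin by simp
        next
          case False
          then obtain j where j: "q = 2 * j"
            by blast
          then show ?thesis
            using u_x[of j] le pin(1) nth_mem[of j xs] len_xs set_xs by simp
        qed
      qed
    qed
  qed
  then show ?thesis
    using perm n_admissible_def by blast
qed

lemma admissible_iff_ballot: "admissible S \<longleftrightarrow> ballot S"
proof
  assume "admissible S"
  then show "ballot S"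
    using ballot_pinnacle_set unfolding admissible_def n_admissible_def by blast
next
  assume S: "ballot S"
  then have fin: "finite S"
    by (simp add: ballot_def)
  \<comment> \<open>Inserting 1 gives the empty set a maximum and ensures
    \<open>n \<ge> 1\<close>.\<close>
  define n where "n = nat (Max (insert 1 S))"
  have "S \<subseteq> {1..int n}"
  proof
    fix s assume s: "s \<in> S"
    then have "0 < s"
      using S unfolding ballot_def by force
    moreover have "s \<le> Max (insert 1 S)"
      using s fin by simp
    ultimately show "s \<in> {1..int n}"
      by (simp add: n_def)
  qed
  moreover have "1 \<le> Max (insert 1 S)"
    using fin by (intro Max_ge) auto
  then have "n \<ge> 1"
    by (simp add: n_def)
  ultimately show "admissible S"
    using ballot_n_admissible[OF S] unfolding admissible_def by blast
qed

section \<open>Counting ballot sets of bounded size\<close>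

text \<open>Bounding the size, rather than fixing it, makes the count a single binomial coefficient
  instead of a difference of two.\<close>

definition ballot_sets :: "nat \<Rightarrow> nat \<Rightarrow> int set set" where
  "ballot_sets n k = {S. ballot S \<and> S \<subseteq> {1..int n} \<and> card S \<le> k}"

lemma finite_ballot_sets: "finite (ballot_sets n k)"
  by (rule finite_subset[of _ "Pow {1..int n}"]) (auto simp: ballot_sets_def)

lemma ballot_sets_0: "ballot_sets n 0 = {{}}"
  by (auto simp: ballot_sets_def ballot_empty dest: finite_subset)

lemma ballot_card_less:
  assumes "ballot S" "S \<subseteq> {1..int n}" "n \<ge> 1"
  shows "2 * card S < n"
proof (cases "S = {}")
  case False
  have "Max S \<in> S"
    using assms False by (simp add: ballot_def)
  then show ?thesis
    using ballot_card_less_Max[OF assms(1) False] assms(2) by force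
qed (use assms in simp)

text \<open>Adding the letter \<open>n + 1\<close> to \<open>T\<close> only imposes
  \<open>2 * (card T + 1) < n + 1\<close>, which the assumption grants whenever
  \<open>card T \<le> k\<close>.\<close>

lemma ballot_with_max:
  assumes "2 * Suc k < Suc n"
  shows "{S \<in> ballot_sets (Suc n) (Suc k). int (Suc n) \<in> S} = insert (int (Suc n)) ` ballot_sets n k"
    (is "?L = ?R")
proof
  show "?R \<subseteq> ?L"
  proof safe
    fix T assume T: "T \<in> ballot_sets n k"
    then have sub: "T \<subseteq> {1..int n}" and card: "card T \<le> k" and "ballot T"
      by (auto simp: ballot_sets_def)
    then have "ballot (insert (int (Suc n)) T)"
      using assms by (subst ballot_insert) force+
    moreover have "card (insert (int (Suc n)) T) \<le> Suc k"
      using card by (intro card_insert_le_m1) auto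
    ultimately show "insert (int (Suc n)) T \<in> ballot_sets (Suc n) (Suc k)"
      using sub by (force simp: ballot_sets_def)
  qed
  show "?L \<subseteq> ?R"
  proof
    fix S assume "S \<in> ?L"
    then have S: "ballot S" "S \<subseteq> {1..int (Suc n)}" "card S \<le> Suc k" "int (Suc n) \<in> S"
      by (auto simp: ballot_sets_def)
    define T where "T = S - {int (Suc n)}"
    have eq: "S = insert (int (Suc n)) T"
      using S by (auto simp: T_def)
    have sub: "T \<subseteq> {1..int n}"
      using S by (force simp: T_def)
    have "ballot T"
      using S(1) sub unfolding eq by (subst (asm) ballot_insert) force+
    moreover have "card T \<le> k"
      using S finite_subset[OF S(2)] by (simp add: T_def)
    ultimately show "S \<in> ?R"
      using sub eq by (auto simp: ballot_sets_def)
  qed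
qed

lemma card_ballot_with_max:
  assumes "2 * Suc k < Suc n"
  shows "card {S \<in> ballot_sets (Suc n) (Suc k). int (Suc n) \<in> S} = card (ballot_sets n k)"
  unfolding ballot_with_max[OF assms]
proof (rule card_image, rule inj_onI)
  fix S T assume *: "S \<in> ballot_sets n k" "T \<in> ballot_sets n k"
    "insert (int (Suc n)) S = insert (int (Suc n)) T"
  then have "int (Suc n) \<notin> S" "int (Suc n) \<notin> T"
    by (auto simp: ballot_sets_def)
  then show "S = T"
    using * by (metis insert_ident)
qed

lemma card_ballot_sets_Suc:
  assumes "2 * Suc k < Suc n"
  shows "card (ballot_sets (Suc n) (Suc k)) = card (ballot_sets n (Suc k)) + card (ballot_sets n k)"
proof -
  have "{1..int n} = {1..int (Suc n)} - {int (Suc n)}"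
    by auto
  then have "ballot_sets n (Suc k) = {S \<in> ballot_sets (Suc n) (Suc k). int (Suc n) \<notin> S}"
    by (auto simp: ballot_sets_def subset_Diff_insert)
  then have "ballot_sets (Suc n) (Suc k) =
      ballot_sets n (Suc k) \<union> {S \<in> ballot_sets (Suc n) (Suc k). int (Suc n) \<in> S}"
    "ballot_sets n (Suc k) \<inter> {S \<in> ballot_sets (Suc n) (Suc k). int (Suc n) \<in> S} = {}"
    by auto
  then show ?thesis
    using card_ballot_with_max[OF assms] finite_ballot_sets
    by (metis (no_types, lifting) card_Un_disjoint finite_Un)
qed

lemma central_binomial_odd: "Suc (2 * k) choose Suc k = Suc (2 * k) choose k"
  by (subst binomial_symmetric) simp_all

text \<open>Below the boundary this is Pascal's rule, by induction on \<open>n\<close>. The inner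
  induction on \<open>k\<close> serves the boundary case, where the count for \<open>Suc k\<close>
  reduces to that for \<open>k\<close>.\<close>

lemma card_ballot_sets: "2 * k \<le> Suc n \<Longrightarrow> card (ballot_sets (Suc n) k) = n choose k"
proof (induction n arbitrary: k)
  case 0
  then have "k = 0"
    by simp
  then show ?case
    by (simp add: ballot_sets_0)
next
  case IH: (Suc n)
  from IH.prems show ?case
  proof (induction k)
    case 0
    then show ?case
      by (simp add: ballot_sets_0)
  next
    case (Suc k)
    show ?case
    proof (cases "2 * Suc k < Suc (Suc n)")
      case True
      then show ?thesis
        using card_ballot_sets_Suc[of k "Suc n"] IH.IH[of k] IH.IH[of "Suc k"] by simp
    next
      case False
      \<comment> \<open>On the boundary no ballot set has \<open>k + 1\<close> elements, and the two
        middle entries of row \<open>2 * k + 1\<close> agree.\<close>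
      then have n: "Suc n = Suc (2 * k)"
        using Suc.prems by simp
      have "card S \<le> k" if "ballot S" "S \<subseteq> {1..int (Suc (Suc n))}" for S
        using ballot_card_less[OF that] n by simp
      then have "ballot_sets (Suc (Suc n)) (Suc k) = ballot_sets (Suc (Suc n)) k"
        unfolding ballot_sets_def using le_SucI by blast
      then show ?thesis
        using Suc.IH Suc.prems central_binomial_odd[of k] n by simp
    qed
  qed
qed

text \<open>By \<open>2 * card S < n\<close>, the size bound \<open>(n - 1) div 2\<close> excludes
  no ballot set.\<close>

lemma card_ballot_subsets:
  assumes "n \<ge> 1"
  shows "card {S. ballot S \<and> S \<subseteq> {1..int n}} = (n - 1) choose ((n - 1) div 2)"
proof -
  have "{S. ballot S \<and> S \<subseteq> {1..int n}} = ballot_sets n ((n - 1) div 2)"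
    using ballot_card_less[OF _ _ assms] unfolding ballot_sets_def by fastforce
  then show ?thesis
    using card_ballot_sets[of "(n - 1) div 2" "n - 1"] assms by simp
qed

section \<open>Sets with a prescribed maximum\<close>

text \<open>For \<open>m \<ge> 3\<close> the size bound equals \<open>(m - 1) div 2\<close>, the
  largest size with \<open>2 * card S < m\<close>. The successor form fits
  \<open>card_ballot_with_max\<close>.\<close>

lemma admissible_with_max_eq:
  assumes "m \<ge> 3"
  shows "admissible_with_max (int m) = {S \<in> ballot_sets m (Suc ((m - 3) div 2)). int m \<in> S}"
proof (intro equalityI subsetI)
  fix S assume "S \<in> admissible_with_max (int m)"
  then have S: "ballot S" "finite S" "S \<noteq> {}" "Max S = int m"
    by (auto simp: admissible_with_max_def admissible_iff_ballot)
  have sub: "S \<subseteq> {1..int m}"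
  proof
    fix s assume s: "s \<in> S"
    then have "0 < s"
      using S unfolding ballot_def by force
    then show "s \<in> {1..int m}"
      using s S Max_ge[of S s] by simp
  qed
  then have "2 * card S < m"
    using ballot_card_less[OF S(1)] assms by simp
  then have "card S \<le> Suc ((m - 3) div 2)"
    by linarith
  then show "S \<in> {S \<in> ballot_sets m (Suc ((m - 3) div 2)). int m \<in> S}"
    using S sub Max_in[of S] by (simp add: ballot_sets_def)
next
  fix S assume "S \<in> {S \<in> ballot_sets m (Suc ((m - 3) div 2)). int m \<in> S}"
  then have S: "ballot S" "S \<subseteq> {1..int m}" "int m \<in> S" "finite S"
    by (auto simp: ballot_sets_def ballot_def)
  then have "Max S = int m"
    by (intro Max_eqI) auto
  then show "S \<in> admissible_with_max (int m)"
    using S by (auto simp: admissible_with_max_def admissible_iff_ballot)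
qed

text \<open>A nonempty set would need \<open>2 \<le> 2 * card S < 2\<close>. This case stands apart
  because \<open>m - 3\<close> truncates; the resulting count agrees with
  \<open>0 choose 1 = 0\<close>.\<close>

lemma admissible_with_max_2: "admissible_with_max 2 = {}"
proof -
  have False if "ballot S" "S \<noteq> {}" "Max S = 2" for S
  proof -
    have "card S \<noteq> 0"
      using that by (simp add: ballot_def)
    then show False
      using ballot_card_less_Max[OF that(1,2)] that(3) by simp
  qed
  then show ?thesis
    by (auto simp: admissible_with_max_def admissible_iff_ballot)
qed

lemma card_admissible_with_max:
  assumes "m \<ge> 2"
  shows "finite (admissible_with_max (int m)) \<and>
         card (admissible_with_max (int m)) = (m - 2) choose (m div 2)"
proof (cases "m = 2")
  case True
  then show ?thesis
    by (simp add: admissible_with_max_2)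
next
  case False
  with assms have m: "m \<ge> 3"
    by simp
  let ?k = "(m - 3) div 2"
  \<comment> \<open>Deleting \<open>m\<close> leaves an arbitrary ballot set in
    \<open>[m - 1]\<close> with at most \<open>?k\<close> elements.\<close>
  have "card (admissible_with_max (int m)) = card (ballot_sets (m - 1) ?k)"
    using card_ballot_with_max[of ?k "m - 1"] m by (simp add: admissible_with_max_eq)
  also have "\<dots> = (m - 2) choose ?k"
  proof -
    have "Suc (m - 2) = m - 1" "2 * ?k \<le> Suc (m - 2)"
      using m by linarith+
    then show ?thesis
      using card_ballot_sets[of ?k "m - 2"] by simp
  qed
  also have "\<dots> = (m - 2) choose (m - 2 - ?k)"
    using m by (intro binomial_symmetric) linarith
  also have "m - 2 - ?k = m div 2"
    using m by linarith
  finally show ?thesis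
    using finite_ballot_sets by (simp add: admissible_with_max_eq[OF m])
qed

section \<open>Summation to the central binomial coefficient\<close>

text \<open>Pascal's rule, preceded for even \<open>n\<close> by exchanging the two middle entries
  of row \<open>n + 1\<close>.\<close>

lemma central_binomial_Suc:
  "Suc n choose (Suc n div 2) = (n choose (n div 2)) + (n choose (Suc (Suc n) div 2))"
proof (cases "even n")
  case True
  then obtain a where "n = 2 * a"
    by blast
  then show ?thesis
    using central_binomial_odd[of a] by simp
next
  case False
  then obtain a where "n = 2 * a + 1"
    by (rule oddE)
  then show ?thesis
    by simp
qed

lemma sum_binomial_central:
  "n \<ge> 1 \<Longrightarrow> 1 + (\<Sum>m = 3..n. (m - 2) choose (m div 2)) = (n - 1) choose ((n - 1) div 2)"
proof (induction n rule: nat_induct_at_least)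
  case (Suc n)
  show ?case
  \<comment> \<open>For \<open>n = 1\<close> the range \<open>3..Suc n\<close> is empty and has no
    last term to split off.\<close>
  proof (cases "n = 1")
    case False
    define l where "l = n - 1"
    have n: "n = Suc l" "n \<ge> 2"
      using False Suc.hyps by (auto simp: l_def)
    have "(\<Sum>m = 3..Suc n. (m - 2) choose (m div 2)) =
        (\<Sum>m = 3..n. (m - 2) choose (m div 2)) + (l choose (Suc n div 2))"
      using n by (subst sum.nat_ivl_Suc') auto
    then show ?thesis
      using Suc.IH central_binomial_Suc[of l] unfolding n(1) diff_Suc_1 by linarith
  qed simp
qed simp

theorem theorem1p8:
  shows "(\<forall>(S :: int set) (m :: int). finite S \<and> S \<noteq> {} \<and> Max S = m \<longrightarrow>
            (admissible S \<longleftrightarrow> admissible (S - {m}) \<and> m > 2 * int (card S)))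
       \<and> (\<forall>m :: nat. m \<ge> 2 \<longrightarrow>
            finite (admissible_with_max (int m)) \<and>
            card (admissible_with_max (int m)) = (m - 2) choose (m div 2))
       \<and> (\<forall>n :: nat. n \<ge> 1 \<longrightarrow>
            card {S. admissible S \<and> S \<subseteq> {1..int n}} = 1 + (\<Sum>m = 3..n. (m - 2) choose (m div 2)) \<and>
            1 + (\<Sum>m = 3..n. (m - 2) choose (m div 2)) = (n - 1) choose ((n - 1) div 2))"
  using ballot_remove_Max card_admissible_with_max card_ballot_subsets sum_binomial_central
  by (simp add: admissible_iff_ballot)

end
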